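(* For all real numbers $\alpha, \beta$, the dilated ceiling functions $g_\alpha$ and $g_\beta$ commute under composition (that is, $g_\alpha(g_\beta(x)) = g_\beta(g_\alpha(x))$ for all $x \in \mathbb{R}$) if and only if the dilated floor functions $f_\alpha$ and $f_\beta$ commute under composition (that is, $f_\alpha(f_\beta(x)) = f_\beta(f_\alpha(x))$ for all $x \in \mathbb{R}$).
   Context: For a real number $\alpha$, define functions $f_\alpha, g_\alpha : \mathbb{R} \to \mathbb{R}$ by $f_\alpha(x) = \lfloor \alpha x \rfloor$ and $g_\alpha(x) = \lceil \alpha x \rceil$, where $\lfloor \cdot \rfloor$ rounds a real number down to the nearest integer and $\lceil \cdot \rceil$ rounds it up to the nearest integer. *)

theory Defs
  imports Complex_Main
begin

definition dilated_floor :: "real \<Rightarrow> real \<Rightarrow> real" where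
  "dilated_floor \<alpha> x = real_of_int \<lfloor>\<alpha> * x\<rfloor>"

definition dilated_ceiling :: "real \<Rightarrow> real \<Rightarrow> real" where
  "dilated_ceiling \<alpha> x = real_of_int \<lceil>\<alpha> * x\<rceil>"

end

theory Submission
  imports Defs
begin

text \<open>Negation conjugates \<open>dilated_floor \<alpha>\<close> into
  \<open>dilated_ceiling \<alpha>\<close>, for every \<alpha> at once, and commuting is invariant
  under a common conjugation. In a composite the two inner negations cancel.\<close>

lemma dilated_ceiling_eq_floor: "dilated_ceiling \<alpha> x = - dilated_floor \<alpha> (- x)"
  by (simp add: dilated_floor_def dilated_ceiling_def ceiling_def)

lemma dilated_ceiling_comp:
  "dilated_ceiling \<alpha> (dilated_ceiling \<beta> x) = - dilated_floor \<alpha> (dilated_floor \<beta> (- x))"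
  by (simp add: dilated_ceiling_eq_floor)

theorem mainTheorem2:
  fixes \<alpha> \<beta> :: real
  shows "(\<forall>x. dilated_ceiling \<alpha> (dilated_ceiling \<beta> x) = dilated_ceiling \<beta> (dilated_ceiling \<alpha> x))
    \<longleftrightarrow> (\<forall>x. dilated_floor \<alpha> (dilated_floor \<beta> x) = dilated_floor \<beta> (dilated_floor \<alpha> x))"
  \<comment> \<open>With the outer signs cancelled, the left side is the floor identity at
    \<open>- x\<close> for all \<open>x\<close>; as negation is onto, \<open>minus_minus\<close>
    recovers it at every point.\<close>
  unfolding dilated_ceiling_comp neg_equal_iff_equal by (metis minus_minus)

end
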